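(* Assume that there exists an almost surely finite random variable $F_0$ such that $F(y)\le F_0$ for every $y\ge 0$. Then a stationary distribution $\pi$ of the Markov chain $\{Z_n\}$ exists, and it satisfies the balance equation $$ \int_{(0,\infty)} g(y)\,\pi(\mathrm{d}y)+g(0)\,\pi(\{0\})=\int_{[0,\infty)}\int_{[0,\infty)}g(y)\, k(x,\mathrm{d}y)\,\pi(\mathrm{d}x) $$ for every bounded measurable function $g:[0,\infty)\to\mathbb{R}$.
   Context: Let $q>0$ and let $X$ be a spectrally positive Lévy process (only positive jumps) whose paths are not monotone; $P_x$ denotes probability given $X(0)=x$. Let $\nu$ be the Lévy measure and $\sigma$ the Gaussian coefficient of $-X$. Standing assumptions: (i) $\sigma>0$, or $\int_{-1}^0|x|\,\nu(\mathrm{d}x)=\infty$, or $\nu$ is absolutely continuous with respect to Lebesgue measure; (ii) $P_x(\tau_0^-<\infty)=1$ for all $x\ge 0$, where $\tau_0^-=\inf\{t\ge 0: X(t)\le 0\}$. Under $P_x$, $x\ge0$, the reflected process is $Y(t)=X(t)-\min\{0,\inf_{s\le t}X(s)\}$, so $Y(0)=x$. Let $e_q^{(1)},e_q^{(2)},\dots$ be i.i.d. exponential random variables with rate $q$ and $F_1,F_2,\dots$ i.i.d. random nonnegative (measurable) functions on $[0,\infty)$, with generic copies $e_q$ and $F$; $X$, the $e_q^{(i)}$ and the $F_i$ are independent. The workload process $V(t)$ evolves between the consecutive epochs $T_i=e_q^{(1)}+\cdots+e_q^{(i)}$ as the reflected process $Y$ (started from the current workload), and at each epoch $V(T_i)=F_i(V(T_i-))$.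 The embedded chain $Z_n=V(T_n)$ (workload just after the adjustment) is a Markov chain on $[0,\infty)$ with transition kernel $k(x,\mathrm{d}y)=P_x(F(Y(e_q))\in \mathrm{d}y)$. *)

theory Defs
  imports "HOL-Probability.Probability"
begin

definition cadlag :: "(real \<Rightarrow> real) \<Rightarrow> bool" where
  "cadlag p \<longleftrightarrow>
     (\<forall>t\<ge>0. (p \<longlongrightarrow> p t) (at_right t)) \<and>
     (\<forall>t>0. \<exists>l. (p \<longlongrightarrow> l) (at_left t))"

text \<open>
  The time set is \<open>[0,\<infinity>)\<close>; values of \<open>X\<close> at negative times are never constrained or used.
  As usual the process is taken in its cadlag version, i.e. every path is cadlag. This makes
  functionals such as running infima measurable without completing the probability space.
\<close>

definition levy_process :: "'w measure \<Rightarrow> (real \<Rightarrow> 'w \<Rightarrow> real) \<Rightarrow> bool" where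
  "levy_process M X \<longleftrightarrow>
     prob_space M \<and>
     (\<forall>t\<ge>0. X t \<in> borel_measurable M) \<and>
     (AE \<omega> in M. X 0 \<omega> = 0) \<and>
     (\<forall>(n::nat) (t::nat \<Rightarrow> real). 0 \<le> t 0 \<and> (\<forall>i<n. t i \<le> t (Suc i)) \<longrightarrow>
        prob_space.indep_vars M (\<lambda>_. borel) (\<lambda>i \<omega>. X (t (Suc i)) \<omega> - X (t i) \<omega>) {..<n}) \<and>
     (\<forall>s\<ge>0. \<forall>t\<ge>0. distr M borel (\<lambda>\<omega>. X (s + t) \<omega> - X s \<omega>) = distr M borel (X t)) \<and>
     (\<forall>\<omega>\<in>space M. cadlag (\<lambda>t. X t \<omega>))"

definition only_positive_jumps :: "'w measure \<Rightarrow> (real \<Rightarrow> 'w \<Rightarrow> real) \<Rightarrow> bool" where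
  "only_positive_jumps M X \<longleftrightarrow>
     (AE \<omega> in M. \<forall>t>0. \<forall>l. ((\<lambda>s. X s \<omega>) \<longlongrightarrow> l) (at_left t) \<longrightarrow> l \<le> X t \<omega>)"

text \<open>
  For a Levy process the event of having nondecreasing (nonincreasing) paths has probability
  \<open>0\<close> or \<open>1\<close>, so it suffices to exclude the almost surely monotone processes.
\<close>

definition monotone_paths :: "'w measure \<Rightarrow> (real \<Rightarrow> 'w \<Rightarrow> real) \<Rightarrow> bool" where
  "monotone_paths M X \<longleftrightarrow>
     (AE \<omega> in M. mono_on {0..} (\<lambda>t. X t \<omega>)) \<or>
     (AE \<omega> in M. antimono_on {0..} (\<lambda>t. X t \<omega>))"

text \<open>
  \<open>a\<close>, \<open>\<sigma>\<close>, \<open>\<nu>\<close> are the drift, the Gaussian coefficient and the Levy measure in the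
  Levy-Khintchine representation of \<open>X\<close>, with truncation function \<open>x 1{\<bar>x\<bar> < 1}\<close>.
\<close>

definition levy_triplet ::
  "'w measure \<Rightarrow> (real \<Rightarrow> 'w \<Rightarrow> real) \<Rightarrow> real \<Rightarrow> real \<Rightarrow> real measure \<Rightarrow> bool" where
  "levy_triplet M X a \<sigma> \<nu> \<longleftrightarrow>
     0 \<le> \<sigma> \<and>
     sets \<nu> = sets borel \<and> emeasure \<nu> {0} = 0 \<and>
     (\<integral>\<^sup>+x. ennreal (min 1 (x\<^sup>2)) \<partial>\<nu>) < \<infinity> \<and>
     (\<forall>t\<ge>0. \<forall>\<theta>. char (distr M borel (X t)) \<theta> =
        exp (of_real t *
          (\<i> * of_real (a * \<theta>) - of_real (\<sigma>\<^sup>2 * \<theta>\<^sup>2 / 2) +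
           (CLINT x|\<nu>. iexp (\<theta> * x) - 1 - \<i> * of_real (\<theta> * x * indicator {-1<..<1} x)))))"

text \<open>The time \<open>\<tau>\<^sub>0\<^sup>-\<close> of a path; it is \<open>\<infinity>\<close> if the path never enters \<open>(-\<infinity>,0]\<close>.\<close>

definition first_passage :: "(real \<Rightarrow> real) \<Rightarrow> ereal" where
  "first_passage p = Inf (ereal ` {t. 0 \<le> t \<and> p t \<le> 0})"

definition reflected :: "(real \<Rightarrow> real) \<Rightarrow> real \<Rightarrow> real" where
  "reflected p t = p t - min 0 (INF s\<in>{0..t}. p s)"

abbreviation nonneg_borel :: "real measure" where
  "nonneg_borel \<equiv> restrict_space borel {0..}"

text \<open>
  \<open>\<F>\<close> is a space of functions \<open>[0,\<infinity>) \<rightarrow> [0,\<infinity>)\<close> on which the evaluation \<open>(f, y) \<mapsto> f y\<close> is jointly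
  measurable; in particular its elements are Borel functions. There is no such sigma-algebra
  on the set of all Borel functions, so the function space is a parameter. Values \<open>f y\<close> with
  \<open>y < 0\<close> are irrelevant.
\<close>

definition random_function ::
  "'w measure \<Rightarrow> (real \<Rightarrow> real) measure \<Rightarrow> ('w \<Rightarrow> real \<Rightarrow> real) \<Rightarrow> bool" where
  "random_function M \<F> F \<longleftrightarrow>
     (\<lambda>(f, y). f y) \<in> measurable (\<F> \<Otimes>\<^sub>M nonneg_borel) nonneg_borel \<and>
     F \<in> measurable M \<F>"

text \<open>Mutual independence of the process \<open>X\<close>, the time \<open>e\<close> and the random function \<open>F\<close>.\<close>

definition independent_inputs ::
  "'w measure \<Rightarrow> (real \<Rightarrow> 'w \<Rightarrow> real) \<Rightarrow> ('w \<Rightarrow> real) \<Rightarrow>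
   (real \<Rightarrow> real) measure \<Rightarrow> ('w \<Rightarrow> real \<Rightarrow> real) \<Rightarrow> bool" where
  "independent_inputs M X e \<F> F \<longleftrightarrow>
     prob_space.indep_sets M
       (\<lambda>i. [sets (vimage_algebra (space M) (\<lambda>\<omega>. \<lambda>t\<in>{0..}. X t \<omega>) (\<Pi>\<^sub>M t\<in>{0..}. borel)),
             sets (vimage_algebra (space M) e borel),
             sets (vimage_algebra (space M) F \<F>)] ! i)
       {..<3}"

text \<open>
  The law of \<open>F (Y e)\<close> under \<open>P\<^sub>x\<close>. Here and in the sequel \<open>M\<close> plays the role of \<open>P\<^sub>0\<close>, and \<open>P\<^sub>x\<close> is
  represented by starting the process as \<open>x + X\<close>.
\<close>

definition workload_kernel ::
  "'w measure \<Rightarrow> (real \<Rightarrow> 'w \<Rightarrow> real) \<Rightarrow> ('w \<Rightarrow> real) \<Rightarrow> ('w \<Rightarrow> real \<Rightarrow> real) \<Rightarrow> real \<Rightarrow> real measure"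
where
  "workload_kernel M X e F x =
     distr M nonneg_borel (\<lambda>\<omega>. F \<omega> (reflected (\<lambda>t. x + X t \<omega>) (e \<omega>)))"

text \<open>
  \<open>\<pi>\<close> is a stationary distribution of the Markov chain with state space \<open>S\<close> and transition kernel
  \<open>K\<close>; that \<open>K\<close> is a Markov kernel is part of the notion.
\<close>

definition stationary_distribution :: "'s measure \<Rightarrow> ('s \<Rightarrow> 's measure) \<Rightarrow> 's measure \<Rightarrow> bool" where
  "stationary_distribution S K \<pi> \<longleftrightarrow>
     K \<in> measurable S (prob_algebra S) \<and>
     prob_space \<pi> \<and> sets \<pi> = sets S \<and>
     (\<forall>A\<in>sets S. emeasure \<pi> A = (\<integral>\<^sup>+x. emeasure (K x) A \<partial>\<pi>))"

end

(* Started from x and from y with the same driving path, the reflected processes coincide from the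
   moment both have been pushed off 0, i.e. once inf X <= - max x y; by independence this happens
   before the exponential time with positive probability, uniformly for x, y <= R. After one step
   the chain lies in [0, R] with positive probability, uniformly in the starting point, because
   F <= F_0. Hence two steps of the kernel contract the oscillation of every bounded measurable
   function by a fixed factor, the laws of Z_n converge setwise at a uniform rate, and the limit is
   stationary. Since F need not be continuous, the convergence has to be in total variation; a
   tightness argument would not suffice. *)
theory Submission
  imports Defs
begin

section \<open>Cadlag paths\<close>

text \<open>On the reals \<open>INF\<close> is a true infimum only for sets bounded below, so this
  underlies the later work with running infima. One-sided limits bound \<open>p\<close> below near
  each point, and bisection (\<open>Bolzano\<close>) patches the local bounds together.\<close>

lemma cadlag_bdd_below:
  assumes p: "cadlag p" and t: "0 \<le> t"
  shows "bdd_below (p ` {0..t})"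
proof -
  \<comment> \<open>The bounds are carried as premises so that bisection only has to treat intervals
    inside \<open>{0..t}\<close>; \<open>cadlag\<close> says nothing about negative times.\<close>
  have "0 \<le> (0::real) \<longrightarrow> t \<le> t \<longrightarrow> bdd_below (p ` {0..t})"
    using t
  proof (induction rule: Bolzano[where P = "\<lambda>u v. 0 \<le> u \<longrightarrow> v \<le> t \<longrightarrow> bdd_below (p ` {u..v})"])
    case (trans u v w)
    show ?case
    proof (intro impI)
      assume "0 \<le> u" "w \<le> t"
      with trans have "bdd_below (p ` {u..v} \<union> p ` {v..w})" by auto
      then show "bdd_below (p ` {u..w})"
        by (rule bdd_below_mono) force
    qed
  next
    case (local x)
    have "\<forall>\<^sub>F s in at_right x. p x - 1 < p s"
      using p local by (intro order_tendstoD(1)[of p "p x"]) (auto simp: cadlag_def)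
    then obtain b where b: "b > x" "\<And>s. x < s \<Longrightarrow> s < b \<Longrightarrow> p x - 1 < p s"
      by (auto simp: eventually_at_right_field)
    obtain a l where a: "a < x" "\<And>s. a < s \<Longrightarrow> s < x \<Longrightarrow> 0 \<le> s \<Longrightarrow> l < p s"
    proof (cases "x = 0")
      case True
      \<comment> \<open>At 0 there is no left limit to use; the claim is vacuous, since no
        \<open>s\<close> satisfies both \<open>s < 0\<close> and \<open>0 \<le> s\<close>.\<close>
      then show ?thesis by (intro that[of "-1"]) auto
    next
      case False
      then obtain l where "(p \<longlongrightarrow> l) (at_left x)"
        using p local unfolding cadlag_def by (metis order_le_neq_trans)
      then have "\<forall>\<^sub>F s in at_left x. l - 1 < p s"
        by (intro order_tendstoD(1)) auto
      then show ?thesis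
        using that by (auto simp: eventually_at_left_field)
    qed
    show ?case
    proof (intro exI[of _ "min (x - a) (b - x)"] conjI allI impI)
      show "0 < min (x - a) (b - x)" using a b by simp
      fix u v assume *: "u \<le> x \<and> x \<le> v \<and> v - u < min (x - a) (b - x)" "0 \<le> u" "v \<le> t"
      show "bdd_below (p ` {u..v})"
      proof (rule bdd_belowI2[of _ "min l (p x - 1)"])
        fix s assume s: "s \<in> {u..v}"
        then consider "a < s" "s < x" "0 \<le> s" | "s = x" | "x < s" "s < b" using * by force
        then show "min l (p x - 1) \<le> p s"
          by cases (use a(2)[of s] b(2)[of s] in auto)
      qed
    qed
  qed
  then show ?thesis by simp
qed

text \<open>Right continuity lets nearby larger rational multiples of \<open>t\<close> stand in for
  each \<open>s < t\<close>. The set of multipliers \<open>r\<close> is countable and independent of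
  \<open>t\<close>, so the formula can be used with a random time in place of
  \<open>t\<close>.\<close>

lemma cadlag_INF_rational:
  assumes p: "cadlag p" and t: "0 \<le> t"
  shows "(INF s\<in>{0..t}. p s) = (INF r\<in>{0..1} \<inter> \<rat>. p (r * t))"
proof (rule antisym)
  have sub: "r * t \<in> {0..t}" if "r \<in> {0..1}" for r
    using that t by (auto simp: mult_left_le_one_le)
  have bdd: "bdd_below ((\<lambda>r. p (r * t)) ` ({0..1} \<inter> \<rat>))"
    by (rule bdd_below_mono[OF cadlag_bdd_below[OF p t]]) (use sub in auto)
  have ne: "{0..1::real} \<inter> \<rat> \<noteq> {}"
  proof -
    have "0 \<in> {0..1::real} \<inter> \<rat>" by simp
    then show ?thesis by blast
  qed
  show "(INF s\<in>{0..t}. p s) \<le> (INF r\<in>{0..1} \<inter> \<rat>. p (r * t))"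
    using ne sub by (intro cINF_greatest cINF_lower cadlag_bdd_below p t) auto
  show "(INF r\<in>{0..1} \<inter> \<rat>. p (r * t)) \<le> (INF s\<in>{0..t}. p s)"
  proof (rule cINF_greatest)
    show "{0..t} \<noteq> {}" using t by simp
    fix s assume s: "s \<in> {0..t}"
    show "(INF r\<in>{0..1} \<inter> \<rat>. p (r * t)) \<le> p s"
    \<comment> \<open>The endpoint is separate: points to its right leave the interval, but
      \<open>t\<close> itself is the multiple with \<open>r = 1\<close>.\<close>
    proof (cases "s = t")
      case True
      then show ?thesis using cINF_lower[OF bdd, of 1] by simp
    next
      case False
      with s have st: "0 \<le> s" "s < t" by auto
      show ?thesis
      proof (rule dense_ge)
        fix y assume "p s < y"
        then have "\<forall>\<^sub>F u in at_right s. p u < y"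
          using p st by (intro order_tendstoD(2)[of p "p s"]) (auto simp: cadlag_def)
        then obtain b where b: "b > s" "\<And>u. s < u \<Longrightarrow> u < b \<Longrightarrow> p u < y"
          by (auto simp: eventually_at_right_field)
        have "s / t < min b t / t" using st b by (intro divide_strict_right_mono) auto
        then obtain r where r: "r \<in> \<rat>" "s / t < r" "r < min b t / t"
          using Rats_dense_in_real by blast
        have rt: "s < r * t" "r * t < min b t" using r st by (auto simp: field_simps)
        have r01: "r \<in> {0..1} \<inter> \<rat>"
        proof -
          have "0 \<le> s / t" using st by simp
          moreover have "r * t < 1 * t" using rt by simp
          then have "r < 1" using st by (simp add: mult_less_cancel_right)
          ultimately show ?thesis using r by auto
        qed
        then show "(INF r\<in>{0..1} \<inter> \<rat>. p (r * t)) \<le> y"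
          using cINF_lower[OF bdd r01] b(2)[of "r * t"] rt by auto
      qed
    qed
  qed
qed

text \<open>\<open>T\<close> is approximated strictly from the right by random times with countably
  many values. At those times measurability is elementary, and right continuity carries it to the
  limit.\<close>

lemma borel_measurable_cadlag_at_time:
  assumes X: "\<And>t. 0 \<le> t \<Longrightarrow> X t \<in> borel_measurable N"
    and cad: "\<And>\<omega>. \<omega> \<in> space N \<Longrightarrow> cadlag (\<lambda>t. X t \<omega>)"
    and T[measurable]: "T \<in> borel_measurable N" and T0: "\<And>\<omega>. \<omega> \<in> space N \<Longrightarrow> 0 \<le> T \<omega>"
  shows "(\<lambda>\<omega>. X (T \<omega>) \<omega>) \<in> borel_measurable N"
proof (rule borel_measurable_LIMSEQ_real)
  \<comment> \<open>Adding 1 after rounding down makes \<open>g n u\<close> strictly larger than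
    \<open>u\<close>, as the filter \<open>at_right\<close> demands, at distance at most
    \<open>1 / real (Suc n)\<close>.\<close>
  define g where "g n u = (real_of_int \<lfloor>real (Suc n) * u\<rfloor> + 1) / real (Suc n)" for n u
  have g: "u < g n u" "g n u \<le> u + 1 / real (Suc n)" for n u
  proof -
    have "real (Suc n) * u < real_of_int \<lfloor>real (Suc n) * u\<rfloor> + 1" by linarith
    then show "u < g n u" by (simp add: g_def field_simps del: of_nat_Suc)
    have "real_of_int \<lfloor>real (Suc n) * u\<rfloor> + 1 \<le> real (Suc n) * u + 1" by linarith
    then have "g n u \<le> (real (Suc n) * u + 1) / real (Suc n)"
      unfolding g_def by (intro divide_right_mono) auto
    then show "g n u \<le> u + 1 / real (Suc n)" by (simp add: add_divide_distrib)
  qed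
  show "(\<lambda>n. X (g n (T \<omega>)) \<omega>) \<longlonglongrightarrow> X (T \<omega>) \<omega>" if w: "\<omega> \<in> space N" for \<omega>
  proof -
    have "(\<lambda>n. g n (T \<omega>)) \<longlonglongrightarrow> T \<omega>"
    proof (rule tendsto_sandwich)
      show "\<forall>\<^sub>F n in sequentially. T \<omega> \<le> g n (T \<omega>)"
        using g(1) by (intro always_eventually allI less_imp_le)
      show "\<forall>\<^sub>F n in sequentially. g n (T \<omega>) \<le> T \<omega> + 1 / real (Suc n)"
        using g(2) by simp
      show "(\<lambda>n. T \<omega> + 1 / real (Suc n)) \<longlonglongrightarrow> T \<omega>"
        using tendsto_add[OF tendsto_const LIMSEQ_Suc[OF lim_1_over_n]] by simp
    qed simp
    then have "filterlim (\<lambda>n. g n (T \<omega>)) (at_right (T \<omega>)) sequentially"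
      using g(1) by (auto simp: filterlim_at intro!: always_eventually less_imp_neq[symmetric])
    moreover have "((\<lambda>t. X t \<omega>) \<longlongrightarrow> X (T \<omega>) \<omega>) (at_right (T \<omega>))"
      using cad[OF w] T0[OF w] by (auto simp: cadlag_def)
    ultimately show ?thesis
      using filterlim_compose[of "\<lambda>t. X t \<omega>" "nhds (X (T \<omega>) \<omega>)" "at_right (T \<omega>)"] by blast
  qed
  show "(\<lambda>\<omega>. X (g n (T \<omega>)) \<omega>) \<in> borel_measurable N" for n
  proof -
    \<comment> \<open>The index \<open>k\<close> runs over all integers, while \<open>X\<close> is
      known to be measurable only at nonnegative times. The cut-off at 0 does not change the values
      that occur, because \<open>T\<close> is nonnegative.\<close>
    define h where "h k = max 0 ((real_of_int k + 1) / real (Suc n))" for k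
    have fl: "(\<lambda>\<omega>. \<lfloor>real (Suc n) * T \<omega>\<rfloor>) \<in> measurable N (count_space UNIV)"
      by (rule measurable_compose[OF _ measurable_real_floor]) (intro borel_measurable_times T borel_measurable_const)
    have Xh: "X (h k) \<in> borel_measurable N" for k
      by (rule X) (simp add: h_def)
    note * = measurable_compose_countable[of "\<lambda>k. X (h k)", OF Xh fl]
    have hg: "h \<lfloor>real (Suc n) * T \<omega>\<rfloor> = g n (T \<omega>)" if "\<omega> \<in> space N" for \<omega>
    proof -
      have "0 \<le> g n (T \<omega>)" using g(1)[of "T \<omega>" n] T0[OF that] by linarith
      then show ?thesis unfolding h_def g_def by (rule max_absorb2)
    qed
    show ?thesis
      by (rule iffD1[OF measurable_cong *]) (simp only: hg)
  qed
qed

text \<open>A countable infimum of values at the random times \<open>r * T\<close>. The measure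
  \<open>N\<close> is general because the lemma is applied both to \<open>M\<close> and to the
  sigma-algebra generated by the path.\<close>

lemma borel_measurable_cadlag_running_INF:
  assumes X: "\<And>t. 0 \<le> t \<Longrightarrow> X t \<in> borel_measurable N"
    and cad: "\<And>\<omega>. \<omega> \<in> space N \<Longrightarrow> cadlag (\<lambda>t. X t \<omega>)"
    and T[measurable]: "T \<in> borel_measurable N" and T0: "\<And>\<omega>. \<omega> \<in> space N \<Longrightarrow> 0 \<le> T \<omega>"
  shows "(\<lambda>\<omega>. INF s\<in>{0..T \<omega>}. X s \<omega>) \<in> borel_measurable N"
proof -
  have "(\<lambda>\<omega>. INF r\<in>{0..1} \<inter> \<rat>. X (r * T \<omega>) \<omega>) \<in> borel_measurable N"
  proof (rule borel_measurable_cINF_real)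
    show "countable ({0..1::real} \<inter> \<rat>)" using countable_rat by (rule countable_Int2)
    show "(\<lambda>\<omega>. X (r * T \<omega>) \<omega>) \<in> borel_measurable N" if "r \<in> {0..1} \<inter> \<rat>" for r
      by (rule borel_measurable_cadlag_at_time[where X = X and T = "\<lambda>\<omega>. r * T \<omega>"])
        (use that T0 X cad in auto)
  qed
  from this show ?thesis
    by (rule measurable_cong[THEN iffD1, rotated])
      (rule cadlag_INF_rational[OF cad T0, symmetric])
qed

text \<open>Pulling the starting point out of the infimum makes the dependence on \<open>x\<close>
  explicit; nonnegativity, joint measurability and the coupling are all read off from this
  formula.\<close>

lemma reflected_add:
  assumes p: "cadlag p" and t: "0 \<le> t"
  shows "reflected (\<lambda>s. x + p s) t = x + p t - min 0 (x + (INF s\<in>{0..t}. p s))"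
proof -
  have "(INF s\<in>{0..t}. x + p s) = x + (INF s\<in>{0..t}. p s)"
    using t by (intro Inf_add_eq cadlag_bdd_below p) auto
  then show ?thesis by (simp add: reflected_def)
qed

lemma reflected_add_nonneg:
  assumes p: "cadlag p" and t: "0 \<le> t"
  shows "0 \<le> reflected (\<lambda>s. x + p s) t"
  using cINF_lower[OF cadlag_bdd_below[OF p t], of t] t by (simp add: reflected_add[OF assms])

section \<open>Setwise limits of probability measures\<close>

text \<open>Finite additivity passes to setwise limits. Countable additivity is reduced to
  continuity at the empty set, and there the rate \<open>\<epsilon>\<close>, uniform in
  \<open>A\<close>, transfers the continuity of a single \<open>\<nu> n\<close> to
  \<open>p\<close>.\<close>

lemma uniform_setwise_limit_measure:
  fixes \<nu> :: "nat \<Rightarrow> 's measure" and p :: "'s set \<Rightarrow> real"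
  assumes prob: "\<And>n. prob_space (\<nu> n)" and sets: "\<And>n. sets (\<nu> n) = sets S"
    and lim: "\<And>n A. A \<in> sets S \<Longrightarrow> \<bar>measure (\<nu> n) A - p A\<bar> \<le> \<epsilon> n" and \<epsilon>: "\<epsilon> \<longlonglongrightarrow> 0"
  shows "\<exists>\<pi>. prob_space \<pi> \<and> sets \<pi> = sets S \<and> (\<forall>A\<in>sets S. measure \<pi> A = p A)"
proof -
  have conv: "(\<lambda>n. measure (\<nu> n) A) \<longlonglongrightarrow> p A" if "A \<in> sets S" for A
    by (rule Lim_transform2[OF tendsto_const[of "p A"]], rule tendsto_rabs_zero_cancel)
      (rule tendsto_sandwich[OF _ _ tendsto_const \<epsilon>],
        use lim[OF that] in \<open>auto simp: abs_minus_commute\<close>)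
  have nn: "0 \<le> p A" if "A \<in> sets S" for A
    by (rule LIMSEQ_le_const[OF conv[OF that]]) auto
  have p_empty: "p {} = 0"
    using conv[of "{}"] by (simp add: LIMSEQ_const_iff)
  have p_space: "p (space S) = 1"
  proof -
    have "measure (\<nu> n) (space S) = 1" for n
      using prob_space.prob_space[OF prob, of n] sets_eq_imp_space_eq[OF sets[of n]] by simp
    then show ?thesis
      using conv[of "space S"] by (simp add: LIMSEQ_const_iff)
  qed
  have p_add: "p (A \<union> B) = p A + p B" if "A \<in> sets S" "B \<in> sets S" "A \<inter> B = {}" for A B
  proof (rule LIMSEQ_unique[OF conv])
    have "measure (\<nu> n) (A \<union> B) = measure (\<nu> n) A + measure (\<nu> n) B" for n
      using prob[of n] that sets[of n]
      by (intro finite_measure.finite_measure_Union prob_space.finite_measure) auto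
    then show "(\<lambda>n. measure (\<nu> n) (A \<union> B)) \<longlonglongrightarrow> p A + p B"
      using tendsto_add[OF conv conv] that by simp
  qed (use that in auto)
  have "countably_additive (sets S) (\<lambda>A. ennreal (p A))"
  proof (rule sets.empty_continuous_imp_countably_additive)
    show "positive (sets S) (\<lambda>A. ennreal (p A))"
      by (simp add: positive_def p_empty)
    show "additive (sets S) (\<lambda>A. ennreal (p A))"
      by (auto simp: additive_def p_add nn ennreal_plus)
    show "\<forall>A\<in>sets S. ennreal (p A) \<noteq> \<infinity>" by simp
    fix A assume A: "range A \<subseteq> sets S" "decseq A" "(\<Inter>i::nat. A i) = {}"
    have "(\<lambda>i. p (A i)) \<longlonglongrightarrow> 0"
    proof (rule LIMSEQ_I)
      fix r :: real assume r: "0 < r"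
      have "\<forall>\<^sub>F n in sequentially. \<epsilon> n < r / 2"
        using \<epsilon> r by (intro order_tendstoD(2)) auto
      then obtain n where n: "\<epsilon> n < r / 2" by (auto simp: eventually_sequentially)
      \<comment> \<open>The index \<open>n\<close> was chosen from \<open>\<epsilon>\<close> alone,
        so this one measure is within \<open>r / 2\<close> of \<open>p\<close> on all sets
        \<open>A i\<close> simultaneously.\<close>
      interpret prob_space "\<nu> n" by (rule prob)
      have "(\<lambda>i. prob (A i)) \<longlonglongrightarrow> 0"
        using finite_Lim_measure_decseq[of A] A sets by simp
      then have "\<forall>\<^sub>F i in sequentially. prob (A i) < r / 2"
        using r by (intro order_tendstoD(2)) auto
      then obtain N where N: "\<And>i. i \<ge> N \<Longrightarrow> prob (A i) < r / 2"
        by (auto simp: eventually_sequentially)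
      have "norm (p (A i) - 0) < r" if "i \<ge> N" for i
        using N[OF that] n lim[of "A i" n] nn[of "A i"] A(1) by (auto simp: abs_le_iff)
      then show "\<exists>N. \<forall>i\<ge>N. norm (p (A i) - 0) < r" by blast
    qed
    then show "(\<lambda>i. ennreal (p (A i))) \<longlonglongrightarrow> 0"
      using tendsto_ennrealI ennreal_0 by fastforce
  qed
  moreover have "positive (sets S) (\<lambda>A. ennreal (p A))"
    by (simp add: positive_def p_empty)
  ultimately have em: "emeasure (measure_of (space S) (sets S) (\<lambda>A. ennreal (p A))) A = ennreal (p A)"
    if "A \<in> sets S" for A
    using that sets.sigma_algebra_axioms
    by (intro emeasure_measure_of_sigma) auto
  show ?thesis
  proof (intro exI conjI ballI)
    show "prob_space (measure_of (space S) (sets S) (\<lambda>A. ennreal (p A)))"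
      by (rule prob_spaceI) (simp add: em p_space)
    show "measure (measure_of (space S) (sets S) (\<lambda>A. ennreal (p A))) A = p A" if "A \<in> sets S" for A
      using em[OF that] nn[OF that] by (simp add: measure_def)
  qed simp
qed

text \<open>At a point \<open>x\<close> the number of levels \<open>j / N\<close> not exceeding
  \<open>g x\<close> is the integer part of \<open>N * g x\<close>, so the sum integrates
  \<open>g\<close> rounded down to a multiple of \<open>1 / N\<close>. The error bound is the same
  for every \<open>\<mu>\<close>.\<close>

lemma integral_approx_level_sets:
  assumes "prob_space \<mu>" and g[measurable]: "g \<in> borel_measurable \<mu>"
    and g01: "\<And>x. x \<in> space \<mu> \<Longrightarrow> 0 \<le> g x \<and> g x \<le> 1" and N: "0 < N"
  shows "\<bar>(\<integral>x. g x \<partial>\<mu>) - (\<Sum>j=1..N. measure \<mu> {x \<in> space \<mu>. real j / real N \<le> g x}) / real N\<bar> \<le> 1 / real N"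
proof -
  interpret prob_space \<mu> by fact
  define h where "h x = (\<Sum>j=1..N. indicator {x \<in> space \<mu>. real j / real N \<le> g x} x) / real N" for x
  have int_h: "integrable \<mu> h" unfolding h_def by (auto intro!: integrable_sum simp: emeasure_eq_measure)
  have int_g: "integrable \<mu> g"
    by (rule integrable_const_bound[of _ 1]) (use g01 in auto)
  have "\<bar>g x - h x\<bar> \<le> 1 / real N" if x: "x \<in> space \<mu>" for x
  proof -
    define k where "k = nat \<lfloor>real N * g x\<rfloor>"
    have k: "real k \<le> real N * g x" "real N * g x < real k + 1"
      using g01[OF x] by (auto simp: k_def of_nat_nat)
    have "real k \<le> real N" using k(1) g01[OF x] mult_left_le[of "g x" "real N"] by auto
    then have "k \<le> N" by simp
    have "(\<Sum>j=1..N. indicator {x \<in> space \<mu>. real j / real N \<le> g x} x) = (\<Sum>j=1..N. if j \<le> k then 1 else 0 :: real)"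
    proof (intro sum.cong refl)
      fix j
      have "real j / real N \<le> g x \<longleftrightarrow> real j \<le> real N * g x" using N by (simp add: field_simps)
      also have "\<dots> \<longleftrightarrow> j \<le> k" using k by linarith
      finally show "indicator {x \<in> space \<mu>. real j / real N \<le> g x} x = (if j \<le> k then 1 else 0 :: real)"
        using x by simp
    qed
    also have "\<dots> = real (card {j \<in> {1..N}. j \<le> k})"
      by (simp add: sum.If_cases Int_def)
    also have "{j \<in> {1..N}. j \<le> k} = {1..k}" using \<open>k \<le> N\<close> by auto
    finally have "h x = real k / real N" by (simp add: h_def)
    then show ?thesis using k N by (simp add: abs_le_iff field_simps)
  qed
  then have "\<bar>\<integral>x. g x - h x \<partial>\<mu>\<bar> \<le> 1 / real N"
    using int_g int_h integral_abs_bound[of \<mu> "\<lambda>x. g x - h x"]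
      integral_mono[of \<mu> "\<lambda>x. \<bar>g x - h x\<bar>" "\<lambda>_. 1 / real N"] by (auto simp: prob_space)
  moreover have "(\<integral>x. h x \<partial>\<mu>) = (\<Sum>j=1..N. measure \<mu> {x \<in> space \<mu>. real j / real N \<le> g x}) / real N"
    by (simp add: h_def Bochner_Integration.integral_sum emeasure_eq_measure Int_def conj_ac)
  ultimately show ?thesis using int_g int_h by simp
qed

text \<open>The integrals are replaced by finite sums over level sets, with an error that does not
  depend on the measure; those sums converge by setwise convergence. No continuity of
  \<open>g\<close> enters.\<close>

lemma setwise_limit_integral:
  fixes g :: "'s \<Rightarrow> real"
  assumes prob: "\<And>n. prob_space (\<nu> n)" "prob_space \<pi>"
    and sets: "\<And>n. sets (\<nu> n) = sets S" "sets \<pi> = sets S"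
    and lim: "\<And>A. A \<in> sets S \<Longrightarrow> (\<lambda>n. measure (\<nu> n) A) \<longlonglongrightarrow> measure \<pi> A"
    and g[measurable]: "g \<in> borel_measurable S" and g01: "\<And>x. x \<in> space S \<Longrightarrow> 0 \<le> g x \<and> g x \<le> 1"
  shows "(\<lambda>n. \<integral>x. g x \<partial>\<nu> n) \<longlonglongrightarrow> (\<integral>x. g x \<partial>\<pi>)"
proof (rule LIMSEQ_I)
  fix r :: real assume r: "0 < r"
  obtain N where N: "0 < N" "1 / real N < r / 3"
    using nat_approx_posE[of "r / 3"] r by (metis divide_pos_pos zero_less_Suc zero_less_numeral)
  define s where "s \<mu> = (\<Sum>j=1..N. measure \<mu> {x \<in> space S. real j / real N \<le> g x}) / real N"
    for \<mu> :: "'s measure"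
  have approx: "\<bar>(\<integral>x. g x \<partial>\<mu>) - s \<mu>\<bar> \<le> 1 / real N"
    if "prob_space \<mu>" "sets \<mu> = sets S" for \<mu>
    using integral_approx_level_sets[OF that(1) _ _ N(1), of g] g g01 that(2) sets_eq_imp_space_eq[OF that(2)]
    by (simp add: s_def cong: measurable_cong_sets)
  have "(\<lambda>n. s (\<nu> n)) \<longlonglongrightarrow> s \<pi>"
    unfolding s_def using N by (intro tendsto_intros lim) auto
  then obtain n0 where n0: "\<And>n. n \<ge> n0 \<Longrightarrow> \<bar>s (\<nu> n) - s \<pi>\<bar> < r / 3"
    using r LIMSEQ_D[of "\<lambda>n. s (\<nu> n)" "s \<pi>" "r / 3"] by (auto simp del: less_divide_eq_numeral1)
  have "norm ((\<integral>x. g x \<partial>\<nu> n) - (\<integral>x. g x \<partial>\<pi>)) < r" if "n \<ge> n0" for n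
    using approx[OF prob(1)[of n] sets(1)] approx[OF prob(2) sets(2)] n0[OF that] N
    unfolding real_norm_def by linarith
  then show "\<exists>n0. \<forall>n\<ge>n0. norm ((\<integral>x. g x \<partial>\<nu> n) - (\<integral>x. g x \<partial>\<pi>)) < r" by blast
qed

section \<open>Kernels contracting the oscillation\<close>

text \<open>Here \<open>D\<close> is any upper bound for the oscillation of \<open>f\<close>, and
  the hypothesis \<open>contr\<close> says that two steps of the kernel shrink it by the factor
  \<open>c\<close>. For indicators this makes the laws of the chain Cauchy at a geometric rate that
  is the same for all sets.\<close>

lemma stationary_distribution_if_contraction:
  fixes S :: "'s measure" and K :: "'s \<Rightarrow> 's measure" and c :: real
  assumes K: "K \<in> S \<rightarrow>\<^sub>M prob_algebra S" and ne: "space S \<noteq> {}" and c: "0 \<le> c" "c < 1"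
    and contr: "\<And>f D x y. f \<in> borel_measurable S \<Longrightarrow>
      (\<And>u v. u \<in> space S \<Longrightarrow> v \<in> space S \<Longrightarrow> f u - f v \<le> D) \<Longrightarrow> x \<in> space S \<Longrightarrow> y \<in> space S \<Longrightarrow>
      (\<integral>z. (\<integral>w. f w \<partial>K z) \<partial>K x) - (\<integral>z. (\<integral>w. f w \<partial>K z) \<partial>K y) \<le> c * D"
  shows "\<exists>\<pi>. stationary_distribution S K \<pi>"
proof -

  \<comment> \<open>Oscillation of the iterates of the transition operator\<close>
  define U :: "('s \<Rightarrow> real) \<Rightarrow> 's \<Rightarrow> real" where "U f x = (\<integral>y. f y \<partial>K x)" for f x
  define osc where "osc f D \<longleftrightarrow> f \<in> borel_measurable S \<and> (\<forall>x\<in>space S. \<forall>y\<in>space S. f x - f y \<le> D)"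
    for f :: "'s \<Rightarrow> real" and D
  obtain x0 where x0: "x0 \<in> space S" using ne by blast
  have K': "K \<in> S \<rightarrow>\<^sub>M subprob_algebra S" by (rule measurable_prob_algebraD[OF K])
  have Kx: "prob_space (K x)" "sets (K x) = sets S" "space (K x) = space S" if "x \<in> space S" for x
    using measurable_space[OF K that] by (auto simp: space_prob_algebra dest: sets_eq_imp_space_eq)
  have oscD: "f \<in> borel_measurable S" "x \<in> space S \<Longrightarrow> y \<in> space S \<Longrightarrow> f x - f y \<le> D"
    if "osc f D" for f D x y
    using that by (auto simp: osc_def)
  have osc_bound: "\<bar>f x\<bar> \<le> \<bar>f x0\<bar> + D" if "osc f D" "x \<in> space S" for f D x
    using oscD(2)[OF that(1) that(2) x0] oscD(2)[OF that(1) x0 that(2)] by linarith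
  have integrable_K: "integrable (K x) f" if "osc f D" "x \<in> space S" for f D x
    using oscD(1)[OF that(1)] osc_bound[OF that(1)] Kx[OF that(2)]
    by (intro finite_measure.integrable_const_bound[where B = "\<bar>f x0\<bar> + D"] prob_space.finite_measure)
      (auto cong: measurable_cong_sets)
  have U_between: "l \<le> U f x \<and> U f x \<le> u"
    if "osc f D" "x \<in> space S" "\<And>y. y \<in> space S \<Longrightarrow> l \<le> f y \<and> f y \<le> u" for f D x l u
  proof -
    interpret prob_space "K x" by (rule Kx(1)[OF that(2)])
    show ?thesis
      unfolding U_def using integrable_K[OF that(1,2)] that(3) Kx(3)[OF that(2)]
      by (auto intro!: integral_ge_const integral_le_const)
  qed
  have U_measurable: "U f \<in> borel_measurable S" if "f \<in> borel_measurable S" for f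
    unfolding U_def by (rule measurable_compose[OF K' integral_measurable_subprob_algebra[OF that]])
  have osc_U: "osc (U f) D" if f: "osc f D" for f D
  proof -
    have "U f x - U f y \<le> D" if x: "x \<in> space S" and y: "y \<in> space S" for x y
    proof -
      \<comment> \<open>Averaging happens twice: \<open>U f y\<close> is within \<open>D\<close> of
        each single value \<open>f z\<close>, hence so is the average \<open>U f x\<close> of these
        values within \<open>D\<close> of \<open>U f y\<close>.\<close>
      have "f z - D \<le> U f y \<and> U f y \<le> f z + D" if "z \<in> space S" for z
        by (rule U_between[OF f y]) (use oscD(2)[OF f] that in \<open>force simp: algebra_simps\<close>)
      then have "U f x \<le> U f y + D"
        using U_between[OF f x, of "U f y - D" "U f y + D"] by (force simp: algebra_simps)
      then show ?thesis by simp
    qed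
    then show ?thesis using U_measurable oscD(1)[OF f] by (auto simp: osc_def)
  qed
  have osc_UU: "osc (U (U f)) (c * D)" if f: "osc f D" for f D
    unfolding osc_def using contr[of f D] oscD[OF f] U_measurable by (auto simp: U_def)
  \<comment> \<open>Each pair of steps contributes one factor \<open>c\<close>; a leftover odd step
    does not increase the oscillation, by \<open>osc_U\<close>.\<close>
  have osc_iter: "osc ((U ^^ n) f) (c ^ (n div 2) * D)" if f: "osc f D" for f D n
  proof (induction n rule: less_induct)
    case (less n)
    consider "n = 0" | "n = 1" | m where "n = Suc (Suc m)"
      by (metis One_nat_def not0_implies_Suc)
    then show ?case
    proof cases
      case (3 m)
      then show ?thesis using osc_UU[OF less.IH[of m]] by (simp add: mult.assoc)
    qed (use f osc_U in auto)
  qed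
  have osc_iter': "osc ((U ^^ n) f) D" if f: "osc f D" for f D n
    by (induction n) (use f osc_U in auto)
  \<comment> \<open>Any further number of averaging steps stays within \<open>D\<close> of every
    single value of \<open>f\<close>. Applied to an iterate that already oscillates little, this
    compares laws at different times.\<close>
  have iter_close: "f y - D \<le> (U ^^ k) f x \<and> (U ^^ k) f x \<le> f y + D"
    if f: "osc f D" and "x \<in> space S" "y \<in> space S" for f D k x y
    using that(2)
  proof (induction k arbitrary: x)
    case 0
    then show ?case using oscD(2)[OF f that(3)] oscD(2)[OF f _ that(3)] by (force simp: algebra_simps)
  next
    case (Suc k)
    then show ?case
      using U_between[OF osc_iter'[OF f] Suc.prems, of "f y - D" k "f y + D"] by simp
  qed

  \<comment> \<open>Laws of the chain started at \<open>x0\<close>, and their setwise limit\<close>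
  define \<nu> where "\<nu> n = ((\<lambda>\<mu>. \<mu> \<bind> K) ^^ n) (return S x0)" for n
  have \<nu>_space: "\<nu> n \<in> space (prob_algebra S)" for n
  proof (induction n)
    case 0
    then show ?case using x0 by (simp add: \<nu>_def space_prob_algebra prob_space_return)
  next
    case (Suc n)
    then show ?case
      using prob_space_bind'[OF Suc K] sets_bind'[OF Suc K] by (simp add: \<nu>_def space_prob_algebra)
  qed
  then have \<nu>: "prob_space (\<nu> n)" "sets (\<nu> n) = sets S" for n
    by (auto simp: space_prob_algebra)
  have bind_K: "(\<integral>x. f x \<partial>(\<mu> \<bind> K)) = (\<integral>x. U f x \<partial>\<mu>)"
    if f: "osc f D" and \<mu>: "prob_space \<mu>" "sets \<mu> = sets S" for f D \<mu>
    unfolding U_def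
  proof (rule integral_bind[where K = S and B = "\<bar>f x0\<bar> + D" and B' = 1])
    show "K \<in> \<mu> \<rightarrow>\<^sub>M subprob_algebra S" using K' by (simp cong: measurable_cong_sets add: \<mu>(2))
    show "finite_measure \<mu>" using \<mu>(1) by (rule prob_space.finite_measure)
    show "AE x in \<mu>. emeasure (K x) (space (K x)) \<le> ennreal 1"
      using Kx(1) sets_eq_imp_space_eq[OF \<mu>(2)] by (auto simp: prob_space.emeasure_space_1)
  qed (use osc_bound[OF f] oscD(1)[OF f] in auto)
  have integral_\<nu>: "(\<integral>x. f x \<partial>\<nu> n) = (U ^^ n) f x0" if "osc f D" for f D n
    using that
  proof (induction n arbitrary: f)
    case 0
    then show ?case using integral_return[OF x0 oscD(1)] by (simp add: \<nu>_def)
  next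
    case (Suc n)
    have "(\<integral>x. f x \<partial>\<nu> (Suc n)) = (\<integral>x. U f x \<partial>\<nu> n)"
      using bind_K[OF Suc.prems \<nu>] by (simp add: \<nu>_def)
    also have "\<dots> = (U ^^ Suc n) f x0"
      using Suc.IH[OF osc_U[OF Suc.prems]] by (simp add: funpow_swap1)
    finally show ?case .
  qed
  have osc_ind: "osc (indicator A) 1" if "A \<in> sets S" for A
    using that by (auto simp: osc_def indicator_def)
  have measure_\<nu>: "measure (\<nu> n) A = (U ^^ n) (indicator A) x0" if "A \<in> sets S" for A n
    using integral_\<nu>[OF osc_ind[OF that], of n] \<nu>(2)[of n] that sets.sets_into_space[OF that]
      sets_eq_imp_space_eq[OF \<nu>(2)[of n]]
    by (simp add: Int_absorb2)

  have \<epsilon>: "(\<lambda>n. c ^ (n div 2)) \<longlonglongrightarrow> 0"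
    by (rule filterlim_compose[OF LIMSEQ_realpow_zero[OF c] filterlim_at_top_div_const_nat]) simp
  have close: "\<bar>measure (\<nu> m) A - measure (\<nu> n) A\<bar> \<le> c ^ (n div 2)"
    if A: "A \<in> sets S" and mn: "n \<le> m" for A m n
  proof -
    \<comment> \<open>At \<open>x0\<close> the left side is the probability of \<open>A\<close> at
      time \<open>m\<close>. The right side averages the function
      \<open>(U ^^ n) (indicator A)\<close>, whose oscillation is at most
      \<open>c ^ (n div 2)\<close> and whose value at \<open>x0\<close> is the probability at time
      \<open>n\<close>.\<close>
    have "(U ^^ m) (indicator A) = (U ^^ (m - n)) ((U ^^ n) (indicator A))"
      using mn by (metis comp_apply funpow_add le_add_diff_inverse2)
    then show ?thesis
      using iter_close[OF osc_iter[OF osc_ind[OF A], of n] x0 x0, of "m - n"]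
      by (simp add: measure_\<nu>[OF A] abs_le_iff algebra_simps)
  qed
  define p where "p A = lim (\<lambda>n. measure (\<nu> n) A)" for A
  have conv: "(\<lambda>n. measure (\<nu> n) A) \<longlonglongrightarrow> p A" if A: "A \<in> sets S" for A
  proof -
    have "Cauchy (\<lambda>n. measure (\<nu> n) A)"
    proof (rule metric_CauchyI)
      fix r :: real assume "0 < r"
      then have "\<forall>\<^sub>F n in sequentially. c ^ (n div 2) < r / 2"
        using \<epsilon> by (intro order_tendstoD(2)) auto
      then obtain N where N: "c ^ (N div 2) < r / 2" by (auto simp: eventually_sequentially)
      have "dist (measure (\<nu> m) A) (measure (\<nu> n) A) < r" if "m \<ge> N" "n \<ge> N" for m n
        using close[OF A that(1)] close[OF A that(2)] N by (simp add: dist_real_def)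
      then show "\<exists>N. \<forall>m\<ge>N. \<forall>n\<ge>N. dist (measure (\<nu> m) A) (measure (\<nu> n) A) < r" by blast
    qed
    then show ?thesis
      unfolding p_def by (simp add: Cauchy_convergent_iff convergent_LIMSEQ_iff)
  qed
  \<comment> \<open>Letting \<open>m\<close> tend to infinity in \<open>close\<close> keeps the
    bound, which depends on \<open>n\<close> but not on \<open>A\<close>.\<close>
  have "\<bar>p A - measure (\<nu> n) A\<bar> \<le> c ^ (n div 2)" if A: "A \<in> sets S" for n A
  proof (rule LIMSEQ_le_const2)
    show "(\<lambda>m. \<bar>measure (\<nu> m) A - measure (\<nu> n) A\<bar>) \<longlonglongrightarrow> \<bar>p A - measure (\<nu> n) A\<bar>"
      by (intro tendsto_intros conv A)
  qed (use close[OF A] in blast)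
  then have p_close: "\<bar>measure (\<nu> n) A - p A\<bar> \<le> c ^ (n div 2)" if "A \<in> sets S" for n A
    using that by (subst abs_minus_commute)
  obtain \<pi> where \<pi>: "prob_space \<pi>" "sets \<pi> = sets S" "\<And>A. A \<in> sets S \<Longrightarrow> measure \<pi> A = p A"
    using uniform_setwise_limit_measure[OF \<nu> p_close \<epsilon>] by auto
  interpret \<pi>: prob_space \<pi> by (rule \<pi>(1))

  \<comment> \<open>Invariance of the limit\<close>
  have "emeasure \<pi> A = (\<integral>\<^sup>+x. emeasure (K x) A \<partial>\<pi>)" if A: "A \<in> sets S" for A
  proof -
    have meas: "(\<lambda>x. measure (K x) A) \<in> borel_measurable S"
      using measurable_compose[OF K measurable_measure_prob_algebra[OF A]] .
    \<comment> \<open>Both sides of this one-step recursion converge as \<open>n\<close> grows. The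
      integrand is merely bounded and measurable in \<open>x\<close>, which suffices for setwise
      convergence.\<close>
    have "(\<integral>x. measure (K x) A \<partial>\<nu> n) = measure (\<nu> (Suc n)) A" for n
    proof -
      have "(\<integral>x. measure (K x) A \<partial>\<nu> n) = (\<integral>x. U (indicator A) x \<partial>\<nu> n)"
        using Kx sets_eq_imp_space_eq[OF \<nu>(2)[of n]] sets.sets_into_space[OF A] A
        by (intro Bochner_Integration.integral_cong) (auto simp: U_def Int_absorb2)
      also have "\<dots> = measure (\<nu> (Suc n)) A"
        using integral_\<nu>[OF osc_U[OF osc_ind[OF A]], of n] by (simp add: measure_\<nu>[OF A] funpow_swap1)
      finally show ?thesis .
    qed
    moreover have "(\<lambda>n. \<integral>x. measure (K x) A \<partial>\<nu> n) \<longlonglongrightarrow> (\<integral>x. measure (K x) A \<partial>\<pi>)"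
      using Kx conv \<pi>
      by (intro setwise_limit_integral[where S = S] \<nu> meas) (auto simp: prob_space.prob_le_1)
    ultimately have eq: "measure \<pi> A = (\<integral>x. measure (K x) A \<partial>\<pi>)"
      using LIMSEQ_unique[OF LIMSEQ_Suc[OF conv[OF A]]] \<pi>(3)[OF A] by simp
    have "(\<integral>\<^sup>+x. emeasure (K x) A \<partial>\<pi>) = (\<integral>\<^sup>+x. ennreal (measure (K x) A) \<partial>\<pi>)"
      using Kx sets_eq_imp_space_eq[OF \<pi>(2)]
      by (intro nn_integral_cong) (auto simp: finite_measure.emeasure_eq_measure prob_space.finite_measure)
    also have "\<dots> = ennreal (\<integral>x. measure (K x) A \<partial>\<pi>)"
    proof (rule nn_integral_eq_integral)
      show "integrable \<pi> (\<lambda>x. measure (K x) A)"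
        using meas Kx sets_eq_imp_space_eq[OF \<pi>(2)] \<pi>(2)
        by (intro \<pi>.integrable_const_bound[where B = 1])
          (auto simp: prob_space.prob_le_1 cong: measurable_cong_sets)
    qed simp
    finally show ?thesis by (simp add: \<pi>.emeasure_eq_measure eq)
  qed
  then show ?thesis
    using K \<pi> by (auto simp: stationary_distribution_def)
qed

section \<open>The workload chain\<close>

text \<open>Once the infimum is at most \<open>- R\<close>, both \<open>x\<close> and
  \<open>y\<close> plus the infimum are nonpositive. The reflected value is then \<open>p t\<close>
  minus the infimum, and the starting point cancels.\<close>

lemma reflected_coupling:
  assumes p: "cadlag p" "0 \<le> t" and "(INF s\<in>{0..t}. p s) \<le> - R" "x \<le> R" "y \<le> R"
  shows "reflected (\<lambda>s. x + p s) t = reflected (\<lambda>s. y + p s) t"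
  using assms by (simp add: reflected_add[OF p])

text \<open>Joint measurability in the starting point and the sample is what makes the workload
  kernel measurable in its starting point.\<close>

lemma measurable_reflected_at_time:
  assumes X: "\<And>t. 0 \<le> t \<Longrightarrow> X t \<in> borel_measurable N"
    and cad: "\<And>\<omega>. \<omega> \<in> space N \<Longrightarrow> cadlag (\<lambda>t. X t \<omega>)"
    and T: "T \<in> borel_measurable N" and T0: "\<And>\<omega>. \<omega> \<in> space N \<Longrightarrow> 0 \<le> T \<omega>"
  shows "(\<lambda>(x, \<omega>). reflected (\<lambda>t. x + X t \<omega>) (T \<omega>)) \<in> nonneg_borel \<Otimes>\<^sub>M N \<rightarrow>\<^sub>M nonneg_borel"
proof (rule measurable_restrict_space2)
  show "(\<lambda>(x, \<omega>). reflected (\<lambda>t. x + X t \<omega>) (T \<omega>)) \<in> space (nonneg_borel \<Otimes>\<^sub>M N) \<rightarrow> {0..}"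
    using reflected_add_nonneg cad T0 by (auto simp: space_pair_measure)
  note [measurable] = borel_measurable_cadlag_at_time[OF X cad T T0]
    borel_measurable_cadlag_running_INF[OF X cad T T0]
  have [measurable]: "(\<lambda>x. x) \<in> nonneg_borel \<rightarrow>\<^sub>M borel"
    by (rule measurable_restrict_space1) simp
  have "(\<lambda>(x, \<omega>). x + X (T \<omega>) \<omega> - min 0 (x + (INF s\<in>{0..T \<omega>}. X s \<omega>)))
      \<in> borel_measurable (nonneg_borel \<Otimes>\<^sub>M N)"
    by measurable
  then show "(\<lambda>(x, \<omega>). reflected (\<lambda>t. x + X t \<omega>) (T \<omega>)) \<in> borel_measurable (nonneg_borel \<Otimes>\<^sub>M N)"
    by (rule measurable_cong[THEN iffD1, rotated]) (auto simp: space_pair_measure reflected_add cad T0)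
qed

text \<open>A countable union of null sets is null. This supplies a deterministic level for
  \<open>F\<^sub>0\<close> and a deterministic horizon for the passage of the path.\<close>

lemma (in prob_space) ex_prob_pos:
  fixes B :: "nat \<Rightarrow> 'a set"
  assumes B: "\<And>n. B n \<in> events" and AE: "AE x in M. \<exists>n. x \<in> B n"
  shows "\<exists>n. 0 < prob (B n)"
proof (rule ccontr)
  assume "\<not> ?thesis"
  then have "prob (B n) = 0" for n
    using measure_nonneg[of M "B n"] by (metis order_le_less)
  then have "AE x in M. \<forall>n. x \<notin> B n"
    using B by (simp add: AE_all_countable prob_eq_0)
  with AE have "AE x in M. False" by eventually_elim auto
  then show False by simp
qed

text \<open>A pathwise gain of \<open>\<beta>\<close> on \<open>A\<close> becomes a gain of
  \<open>\<beta> * prob A\<close> in the mean.\<close>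

lemma (in prob_space) integral_diff_le:
  fixes g h :: "'a \<Rightarrow> real"
  assumes "integrable M g" "integrable M h" and A: "A \<in> events"
    and le: "AE x in M. g x - h x \<le> D - \<beta> * indicator A x"
  shows "(\<integral>x. g x \<partial>M) - (\<integral>x. h x \<partial>M) \<le> D - \<beta> * prob A"
proof -
  have int: "integrable M (\<lambda>x. D - \<beta> * indicator A x)"
    using A by (auto simp: emeasure_eq_measure)
  have "(\<integral>x. g x \<partial>M) - (\<integral>x. h x \<partial>M) = (\<integral>x. g x - h x \<partial>M)"
    using assms by simp
  also have "\<dots> \<le> (\<integral>x. D - \<beta> * indicator A x \<partial>M)"
    by (rule integral_mono_AE) (use assms int in auto)
  also have "\<dots> = D - \<beta> * prob A"
    using A by (simp add: emeasure_eq_measure prob_space)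
  finally show ?thesis .
qed

lemma measurable_vimage_process:
  assumes "t \<in> I"
  shows "X t \<in> borel_measurable (vimage_algebra \<Omega> (\<lambda>\<omega>. \<lambda>t\<in>I. X t \<omega>) (\<Pi>\<^sub>M t\<in>I. borel))"
proof -
  have "(\<lambda>\<omega>. \<lambda>t\<in>I. X t \<omega>) \<in> vimage_algebra \<Omega> (\<lambda>\<omega>. \<lambda>t\<in>I. X t \<omega>) (\<Pi>\<^sub>M t\<in>I. borel) \<rightarrow>\<^sub>M (\<Pi>\<^sub>M t\<in>I. borel)"
    by (rule measurable_vimage_algebra1) (auto simp: space_PiM)
  from measurable_compose[OF this measurable_component_singleton[OF assms]]
  show ?thesis using assms by simp
qed

text \<open>The path reaches \<open>- R\<close> before some fixed time \<open>n\<close> with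
  positive probability, and \<open>e\<close> exceeds \<open>n\<close> with probability
  \<open>exp (- real n * q)\<close>. By independence both happen together with positive
  probability.\<close>

lemma running_INF_prob_pos:
  assumes "prob_space M" and cad: "\<And>\<omega>. \<omega> \<in> space M \<Longrightarrow> cadlag (\<lambda>t. X t \<omega>)"
    and fp: "AE \<omega> in M. first_passage (\<lambda>t. R + X t \<omega>) < \<infinity>"
    and q: "q > 0" and e: "distributed M lborel e (exponential_density q)"
    and e0: "\<And>\<omega>. \<omega> \<in> space M \<Longrightarrow> 0 \<le> e \<omega>"
    and indep: "independent_inputs M X e \<F> F"
  shows "0 < measure M {\<omega> \<in> space M. (INF s\<in>{0..e \<omega>}. X s \<omega>) \<le> - R}" (is "0 < measure M ?A")
proof -
  interpret prob_space M by fact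
  \<comment> \<open>Independence is stated for this sigma-algebra, so the event \<open>B n\<close>
    below has to be shown measurable with respect to it and not just with respect to
    \<open>M\<close>.\<close>
  define \<Sigma> where "\<Sigma> = vimage_algebra (space M) (\<lambda>\<omega>. \<lambda>t\<in>{0..}. X t \<omega>) (\<Pi>\<^sub>M t\<in>{0..}. borel)"
  have space_\<Sigma>: "space \<Sigma> = space M" by (simp add: \<Sigma>_def)
  have X_\<Sigma>: "X t \<in> borel_measurable \<Sigma>" if "0 \<le> t" for t
    unfolding \<Sigma>_def by (rule measurable_vimage_process) (use that in simp)
  note ind = indep[unfolded independent_inputs_def, folded \<Sigma>_def]
  have \<Sigma>_events: "sets \<Sigma> \<subseteq> events"
    using ind unfolding indep_sets_def by (auto dest!: bspec[of _ _ 0])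
  have X: "X t \<in> borel_measurable M" if "0 \<le> t" for t
    using X_\<Sigma>[OF that] \<Sigma>_events space_\<Sigma> by (auto simp: measurable_def)
  have [measurable]: "e \<in> borel_measurable M" using distributed_measurable[OF e] by simp
  define B where "B n = {\<omega> \<in> space M. (INF s\<in>{0..real n}. X s \<omega>) \<le> - R}" for n
  define C where "C n = {\<omega> \<in> space M. real n < e \<omega>}" for n
  have B: "B n \<in> sets \<Sigma>" for n
  proof -
    have [measurable]: "(\<lambda>\<omega>. INF s\<in>{0..real n}. X s \<omega>) \<in> borel_measurable \<Sigma>"
      by (rule borel_measurable_cadlag_running_INF[where T = "\<lambda>_. real n" and X = X])
        (use X_\<Sigma> cad space_\<Sigma> in auto)
    show ?thesis unfolding B_def space_\<Sigma>[symmetric] by measurable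
  qed
  have C: "C n \<in> sets (vimage_algebra (space M) e borel)" for n
  proof -
    have "e -` {real n<..} \<inter> space M \<in> sets (vimage_algebra (space M) e borel)"
      by (rule in_vimage_algebra) simp
    also have "e -` {real n<..} \<inter> space M = C n" by (auto simp: C_def)
    finally show ?thesis .
  qed
  have "AE \<omega> in M. \<exists>n. \<omega> \<in> B n"
    using fp AE_space
  proof eventually_elim
    case (elim \<omega>)
    \<comment> \<open>Finiteness of the passage time yields an actual time at which the path is at
      most \<open>- R\<close>, because the infimum of the empty set is infinite.\<close>
    then have "ereal ` {t. 0 \<le> t \<and> R + X t \<omega> \<le> 0} \<noteq> {}"
      by (metis first_passage_def Inf_empty top_ereal_def order_less_irrefl)
    then obtain t where t: "0 \<le> t" "R + X t \<omega> \<le> 0" by blast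
    obtain n where n: "t \<le> real n" using real_arch_simple by blast
    have "(INF s\<in>{0..real n}. X s \<omega>) \<le> X t \<omega>"
      using t n elim by (intro cINF_lower cadlag_bdd_below cad) auto
    then show ?case using t elim by (auto simp: B_def intro!: exI[of _ n])
  qed
  then obtain n where n: "0 < prob (B n)"
    using ex_prob_pos[of B] B \<Sigma>_events by blast
  have "prob (B n \<inter> C n) = prob (B n) * prob (C n)"
    \<comment> \<open>The indices 0 and 1 are the positions of the path and of \<open>e\<close> in
      the list of sigma-algebras.\<close>
    using indep_setsD[OF ind, where J = "{0, 1}" and A = "\<lambda>i. if i = 0 then B n else C n"] B C by (auto simp: Int_commute)
  also have "prob (C n) = exp (- real n * q)"
    unfolding C_def using exponential_distributedD_gt[OF e _ q] by simp
  finally have "0 < prob (B n \<inter> C n)" using n by simp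
  also have "prob (B n \<inter> C n) \<le> prob ?A"
  proof (rule finite_measure_mono)
    have [measurable]: "(\<lambda>\<omega>. INF s\<in>{0..e \<omega>}. X s \<omega>) \<in> borel_measurable M"
      by (rule borel_measurable_cadlag_running_INF[where T = e and X = X]) (use X cad e0 in auto)
    show "?A \<in> events" by measurable
    show "B n \<inter> C n \<subseteq> ?A"
    proof
      fix \<omega> assume "\<omega> \<in> B n \<inter> C n"
      then have \<omega>: "\<omega> \<in> space M" "(INF s\<in>{0..real n}. X s \<omega>) \<le> - R" "real n < e \<omega>"
        by (auto simp: B_def C_def)
      have "(INF s\<in>{0..e \<omega>}. X s \<omega>) \<le> (INF s\<in>{0..real n}. X s \<omega>)"
        using \<omega> e0 by (intro cINF_superset_mono cadlag_bdd_below cad) auto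
      with \<omega> show "\<omega> \<in> ?A" by simp
    qed
  qed
  finally show ?thesis .
qed

text \<open>Invariance on sets says that \<open>\<pi>\<close> and \<open>\<pi> \<bind> K\<close> are
  the same measure; integrating \<open>g\<close> against both gives the identity.\<close>

lemma integral_stationary_distribution:
  fixes g :: "'s \<Rightarrow> real"
  assumes stat: "stationary_distribution S K \<pi>" and g: "g \<in> borel_measurable S"
    and B: "\<And>x. x \<in> space S \<Longrightarrow> \<bar>g x\<bar> \<le> B"
  shows "(\<integral>x. g x \<partial>\<pi>) = (\<integral>x. (\<integral>y. g y \<partial>K x) \<partial>\<pi>)"
proof -
  have K: "K \<in> S \<rightarrow>\<^sub>M prob_algebra S" and \<pi>: "prob_space \<pi>" "sets \<pi> = sets S"
    and inv: "\<And>A. A \<in> sets S \<Longrightarrow> emeasure \<pi> A = (\<integral>\<^sup>+x. emeasure (K x) A \<partial>\<pi>)"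
    using stat by (auto simp: stationary_distribution_def)
  have space: "\<pi> \<in> space (prob_algebra S)" using \<pi> by (simp add: space_prob_algebra)
  have "\<pi> = \<pi> \<bind> K"
    using sets_bind'[OF space K] emeasure_bind_prob_algebra[OF space K]
    by (intro measure_eqI) (auto simp: \<pi>(2) inv)
  then have "(\<integral>x. g x \<partial>\<pi>) = (\<integral>x. g x \<partial>(\<pi> \<bind> K))" by simp
  also have "\<dots> = (\<integral>x. (\<integral>y. g y \<partial>K x) \<partial>\<pi>)"
  proof (rule integral_bind[where K = S and B = B and B' = 1])
    show "K \<in> \<pi> \<rightarrow>\<^sub>M subprob_algebra S"
      using measurable_prob_algebraD[OF K] by (simp cong: measurable_cong_sets add: \<pi>(2))
    show "finite_measure \<pi>" using \<pi>(1) by (rule prob_space.finite_measure)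
    show "AE x in \<pi>. emeasure (K x) (space (K x)) \<le> ennreal 1"
      using measurable_space[OF K] sets_eq_imp_space_eq[OF \<pi>(2)]
      by (auto simp: space_prob_algebra prob_space.emeasure_space_1)
  qed (use g B in auto)
  finally show ?thesis .
qed

theorem lemma3p2:
  fixes M :: "'w measure" and X :: "real \<Rightarrow> 'w \<Rightarrow> real"
    and a \<sigma> q :: real and \<nu> :: "real measure"
    and e :: "'w \<Rightarrow> real"
    and \<F> :: "(real \<Rightarrow> real) measure" and F :: "'w \<Rightarrow> real \<Rightarrow> real"
    and F\<^sub>0 :: "'w \<Rightarrow> ereal"
  assumes "levy_process M X" and "only_positive_jumps M X" and "\<not> monotone_paths M X"
    and "levy_triplet M (\<lambda>t \<omega>. - X t \<omega>) a \<sigma> \<nu>"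
    and "\<sigma> > 0 \<or> (\<integral>\<^sup>+x\<in>{-1<..<0}. ennreal \<bar>x\<bar> \<partial>\<nu>) = \<infinity> \<or> absolutely_continuous lborel \<nu>"
    and "\<And>x. x \<ge> 0 \<Longrightarrow> AE \<omega> in M. first_passage (\<lambda>t. x + X t \<omega>) < \<infinity>"
    and "q > 0"
    and "distributed M lborel e (exponential_density q)" and "\<And>\<omega>. \<omega> \<in> space M \<Longrightarrow> e \<omega> \<ge> 0"
    and "random_function M \<F> F"
    and "independent_inputs M X e \<F> F"
    and "F\<^sub>0 \<in> borel_measurable M" and "AE \<omega> in M. F\<^sub>0 \<omega> < \<infinity>"
    and "AE \<omega> in M. \<forall>y\<ge>0. ereal (F \<omega> y) \<le> F\<^sub>0 \<omega>"
  shows "(\<exists>\<pi>. stationary_distribution nonneg_borel (workload_kernel M X e F) \<pi>) \<and>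
    (\<forall>\<pi>. stationary_distribution nonneg_borel (workload_kernel M X e F) \<pi> \<longrightarrow>
      (\<forall>g :: real \<Rightarrow> real. g \<in> borel_measurable nonneg_borel \<and> bounded (g ` {0..}) \<longrightarrow>
        (LINT y:{0<..}|\<pi>. g y) + g 0 * measure \<pi> {0} =
        (LINT x|\<pi>. LINT y|workload_kernel M X e F x. g y)))"
proof (intro conjI allI impI)
  interpret prob_space M using assms(1) by (simp add: levy_process_def)
  have X: "\<And>t. 0 \<le> t \<Longrightarrow> X t \<in> borel_measurable M"
    and cad: "\<And>\<omega>. \<omega> \<in> space M \<Longrightarrow> cadlag (\<lambda>t. X t \<omega>)"
    using assms(1) by (auto simp: levy_process_def)
  note e0 = assms(9)
  have e: "e \<in> borel_measurable M" using distributed_measurable[OF assms(8)] by simp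
  \<comment> \<open>The state after one step from \<open>x\<close>, with one sample driving all
    starting points. This common randomness is the coupling.\<close>
  define \<phi> where "\<phi> x \<omega> = F \<omega> (reflected (\<lambda>t. x + X t \<omega>) (e \<omega>))" for x \<omega>
  define K where "K x = distr M nonneg_borel (\<phi> x)" for x
  have K_eq: "workload_kernel M X e F = K"
    by (rule ext) (simp add: workload_kernel_def K_def \<phi>_def[abs_def])
  have space_nn: "space nonneg_borel = {0..}" by (simp add: space_restrict_space)

  \<comment> \<open>Measurability of the transition kernel\<close>
  have \<phi>_pair: "(\<lambda>(x, \<omega>). \<phi> x \<omega>) \<in> nonneg_borel \<Otimes>\<^sub>M M \<rightarrow>\<^sub>M nonneg_borel"
  proof -
    have F: "F \<in> M \<rightarrow>\<^sub>M \<F>" "(\<lambda>(f, y). f y) \<in> \<F> \<Otimes>\<^sub>M nonneg_borel \<rightarrow>\<^sub>M nonneg_borel"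
      using assms(10) by (auto simp: random_function_def)
    have "(\<lambda>z. (F (snd z), case z of (x, \<omega>) \<Rightarrow> reflected (\<lambda>t. x + X t \<omega>) (e \<omega>)))
        \<in> nonneg_borel \<Otimes>\<^sub>M M \<rightarrow>\<^sub>M \<F> \<Otimes>\<^sub>M nonneg_borel"
      by (intro measurable_Pair measurable_compose[OF measurable_snd F(1)]
          measurable_reflected_at_time X cad e e0)
    from measurable_compose[OF this F(2)] show ?thesis
      by (simp add: \<phi>_def case_prod_beta')
  qed
  have \<phi>: "\<phi> x \<in> M \<rightarrow>\<^sub>M nonneg_borel" if "0 \<le> x" for x
    using measurable_Pair2[OF \<phi>_pair, of x] that by (simp add: space_nn)
  have \<phi>_nonneg: "0 \<le> \<phi> x \<omega>" if "0 \<le> x" "\<omega> \<in> space M" for x \<omega>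
    using measurable_space[OF \<phi>[OF that(1)] that(2)] by (simp add: space_nn)
  have K: "K \<in> nonneg_borel \<rightarrow>\<^sub>M prob_algebra nonneg_borel"
    unfolding K_def[abs_def]
    by (rule measurable_distr_prob_space2[OF _ \<phi>_pair])
      (auto simp: space_prob_algebra prob_space_axioms)
  have int_K: "(\<integral>y. f y \<partial>K x) = (\<integral>\<omega>. f (\<phi> x \<omega>) \<partial>M)"
    if "f \<in> borel_measurable nonneg_borel" "0 \<le> x" for f :: "real \<Rightarrow> real" and x
    unfolding K_def by (rule integral_distr[OF \<phi>[OF that(2)] that(1)])

  \<comment> \<open>Two-step contraction for the workload kernel\<close>
  have "AE \<omega> in M. \<exists>n. \<omega> \<in> {\<omega> \<in> space M. F\<^sub>0 \<omega> \<le> ereal (real n)}"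
    using assms(13) AE_space
  proof eventually_elim
    case (elim \<omega>)
    then show ?case
      using real_arch_simple by (cases "F\<^sub>0 \<omega>") auto
  qed
  then obtain n where n: "0 < prob {\<omega> \<in> space M. F\<^sub>0 \<omega> \<le> ereal (real n)}"
    using ex_prob_pos[of "\<lambda>n. {\<omega> \<in> space M. F\<^sub>0 \<omega> \<le> ereal (real n)}"] assms(12) by auto
  \<comment> \<open>The same \<open>R\<close> bounds the state after the first step and sets the
    depth that the path must reach during the second.\<close>
  define R where "R = real n"
  define G where "G = {\<omega> \<in> space M. F\<^sub>0 \<omega> \<le> ereal R}"
  define A where "A = {\<omega> \<in> space M. (INF s\<in>{0..e \<omega>}. X s \<omega>) \<le> - R}"
  have G: "G \<in> events" "0 < prob G" using n assms(12) by (auto simp: G_def R_def)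
  have [measurable]: "(\<lambda>\<omega>. INF s\<in>{0..e \<omega>}. X s \<omega>) \<in> borel_measurable M"
    by (rule borel_measurable_cadlag_running_INF[where T = e and X = X]) (use X cad e e0 in auto)
  have A_events: "A \<in> events" unfolding A_def by measurable
  have A_pos: "0 < prob A"
    unfolding A_def using assms(6)[of R] assms(7,8,11) e0 cad
    by (intro running_INF_prob_pos[where q = q and \<F> = \<F> and F = F]) (auto simp: R_def prob_space_axioms)
  \<comment> \<open>The product comes from two successive integrations: \<open>G\<close> belongs to
    the first step of the chain, \<open>A\<close> to the second.\<close>
  define c where "c = 1 - prob A * prob G"
  show "\<exists>\<pi>. stationary_distribution nonneg_borel (workload_kernel M X e F) \<pi>"
    unfolding K_eq
  proof (rule stationary_distribution_if_contraction[OF K, where c = c])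
    show "space nonneg_borel \<noteq> {}" by (simp add: space_nn)
    show "0 \<le> c" by (simp add: c_def mult_le_one)
    show "c < 1" using A_pos G(2) by (simp add: c_def)
    fix f :: "real \<Rightarrow> real" and D x y
    assume f: "f \<in> borel_measurable nonneg_borel"
      and osc: "\<And>u v. u \<in> space nonneg_borel \<Longrightarrow> v \<in> space nonneg_borel \<Longrightarrow> f u - f v \<le> D"
      and xy: "x \<in> space nonneg_borel" "y \<in> space nonneg_borel"
    define U where "U h z = (\<integral>w. h w \<partial>K z)" for h :: "real \<Rightarrow> real" and z
    have int_\<phi>: "integrable M (\<lambda>\<omega>. h (\<phi> z \<omega>))"
      if h: "h \<in> borel_measurable nonneg_borel" "\<And>u v. 0 \<le> u \<Longrightarrow> 0 \<le> v \<Longrightarrow> h u - h v \<le> D"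
        and "0 \<le> z" for h :: "real \<Rightarrow> real" and z
    proof (rule integrable_const_bound[where B = "\<bar>h 0\<bar> + D"])
      have "\<bar>h u\<bar> \<le> \<bar>h 0\<bar> + D" if "0 \<le> u" for u
        using h(2)[OF that, of 0] h(2)[OF _ that, of 0] by linarith
      then show "AE \<omega> in M. norm (h (\<phi> z \<omega>)) \<le> \<bar>h 0\<bar> + D"
        using \<phi>_nonneg[OF that(3)] by auto
      show "(\<lambda>\<omega>. h (\<phi> z \<omega>)) \<in> borel_measurable M"
        by (rule measurable_compose[OF \<phi>[OF that(3)] h(1)])
    qed
    \<comment> \<open>This one-step estimate is used three times: with no gain for
      \<open>osc_U\<close>, with gain \<open>D\<close> on \<open>A\<close> for
      \<open>U_close\<close>, and with gain \<open>D * prob A\<close> on \<open>G\<close> for the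
      two-step bound.\<close>
    have U_diff: "U h u - U h v \<le> D - \<beta> * prob E"
      if h: "h \<in> borel_measurable nonneg_borel" "\<And>u v. 0 \<le> u \<Longrightarrow> 0 \<le> v \<Longrightarrow> h u - h v \<le> D"
        and "0 \<le> u" "0 \<le> v" "E \<in> events"
        and "AE \<omega> in M. \<omega> \<in> E \<longrightarrow> h (\<phi> u \<omega>) - h (\<phi> v \<omega>) \<le> D - \<beta>" for h u v \<beta> E
      unfolding U_def int_K[OF h(1) \<open>0 \<le> u\<close>] int_K[OF h(1) \<open>0 \<le> v\<close>]
    proof (rule integral_diff_le)
      show "AE \<omega> in M. h (\<phi> u \<omega>) - h (\<phi> v \<omega>) \<le> D - \<beta> * indicator E \<omega>"
        using that(6) AE_space
      proof eventually_elim
        case (elim \<omega>)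
        then show ?case
          using h(2)[OF \<phi>_nonneg[OF \<open>0 \<le> u\<close>] \<phi>_nonneg[OF \<open>0 \<le> v\<close>], of \<omega> \<omega>] by (auto simp: indicator_def)
      qed
    qed (use int_\<phi> that in auto)
    have osc_f: "f u - f v \<le> D" if "0 \<le> u" "0 \<le> v" for u v
      using osc that by (simp add: space_nn)
    have U_meas: "U f \<in> borel_measurable nonneg_borel"
      unfolding U_def
      by (rule measurable_compose[OF measurable_prob_algebraD[OF K] integral_measurable_subprob_algebra[OF f]])
    have osc_U: "U f u - U f v \<le> D" if "0 \<le> u" "0 \<le> v" for u v
      using U_diff[OF f osc_f that, of "{}" 0] by simp
    have U_close: "U f u - U f v \<le> D - D * prob A" if "0 \<le> u" "0 \<le> v" "u \<le> R" "v \<le> R" for u v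
    proof (rule U_diff[OF f osc_f that(1,2) A_events])
      \<comment> \<open>On \<open>A\<close> the workloads before adjustment agree, and the same
        function \<open>F \<omega>\<close> is applied to both, so the full oscillation
        \<open>D\<close> is gained.\<close>
      have "\<phi> u \<omega> = \<phi> v \<omega>" if "\<omega> \<in> A" for \<omega>
        unfolding \<phi>_def using that \<open>u \<le> R\<close> \<open>v \<le> R\<close> cad e0
        by (auto simp: A_def intro!: arg_cong[where f = "F \<omega>"] reflected_coupling[where R = R])
      then show "AE \<omega> in M. \<omega> \<in> A \<longrightarrow> f (\<phi> u \<omega>) - f (\<phi> v \<omega>) \<le> D - D" by simp
    qed
    \<comment> \<open>On \<open>G\<close> the bound \<open>F\<^sub>0\<close> puts both states after
      the first step into \<open>[0, R]\<close>, wherever the chain started, so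
      \<open>U_close\<close> applies to them.\<close>
    have "U (U f) x - U (U f) y \<le> D - D * prob A * prob G"
    proof (rule U_diff[OF U_meas osc_U _ _ G(1)])
      show "0 \<le> x" "0 \<le> y" using xy by (auto simp: space_nn)
      show "AE \<omega> in M. \<omega> \<in> G \<longrightarrow> U f (\<phi> x \<omega>) - U f (\<phi> y \<omega>) \<le> D - D * prob A"
        using assms(14) AE_space
      proof (eventually_elim, intro impI)
        fix \<omega> assume F\<^sub>0: "\<forall>y\<ge>0. ereal (F \<omega> y) \<le> F\<^sub>0 \<omega>" and \<omega>: "\<omega> \<in> space M" "\<omega> \<in> G"
        have "\<phi> z \<omega> \<le> R" if "0 \<le> z" for z
        proof -
          have "ereal (\<phi> z \<omega>) \<le> F\<^sub>0 \<omega>"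
            unfolding \<phi>_def using F\<^sub>0 reflected_add_nonneg[OF cad e0] \<omega>(1) by simp
          also have "\<dots> \<le> ereal R" using \<omega>(2) by (simp add: G_def)
          finally show ?thesis by simp
        qed
        then show "U f (\<phi> x \<omega>) - U f (\<phi> y \<omega>) \<le> D - D * prob A"
          using \<open>0 \<le> x\<close> \<open>0 \<le> y\<close> \<omega>(1) by (intro U_close \<phi>_nonneg) auto
      qed
    qed
    then show "(\<integral>z. (\<integral>w. f w \<partial>K z) \<partial>K x) - (\<integral>z. (\<integral>w. f w \<partial>K z) \<partial>K y) \<le> c * D"
      by (simp add: U_def c_def algebra_simps)
  qed

  \<comment> \<open>The balance equation\<close>
  fix \<pi> and g :: "real \<Rightarrow> real"
  assume stat: "stationary_distribution nonneg_borel (workload_kernel M X e F) \<pi>"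
    and "g \<in> borel_measurable nonneg_borel \<and> bounded (g ` {0..})"
  then obtain B where g: "g \<in> borel_measurable nonneg_borel" and B: "\<And>x. 0 \<le> x \<Longrightarrow> \<bar>g x\<bar> \<le> B"
    by (auto simp: bounded_iff)
  have \<pi>: "prob_space \<pi>" "sets \<pi> = sets nonneg_borel"
    using stat by (auto simp: stationary_distribution_def)
  interpret \<pi>: prob_space \<pi> by (rule \<pi>(1))
  have space_\<pi>: "space \<pi> = {0..}" using sets_eq_imp_space_eq[OF \<pi>(2)] by (simp add: space_nn)
  have sets_\<pi>: "{0<..} \<in> sets \<pi>" "{0} \<in> sets \<pi>"
    by (auto simp: \<pi>(2) sets_restrict_space_iff)
  have int_g: "integrable \<pi> g"
    using g B by (intro \<pi>.integrable_const_bound[where B = B])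
      (auto simp: space_\<pi> \<pi>(2) cong: measurable_cong_sets)
  \<comment> \<open>Since \<open>\<pi>\<close> lives on \<open>{0..}\<close>, splitting off the atom
    at 0 turns the left side of the balance equation into the plain integral of
    \<open>g\<close>.\<close>
  have "(\<integral>x. g x \<partial>\<pi>) = (\<integral>x. indicator {0<..} x * g x + g 0 * indicator {0} x \<partial>\<pi>)"
    by (intro Bochner_Integration.integral_cong) (auto simp: space_\<pi> indicator_def)
  also have "\<dots> = (LINT y:{0<..}|\<pi>. g y) + g 0 * measure \<pi> {0}"
    using int_g sets_\<pi>
    by (subst Bochner_Integration.integral_add)
      (auto simp: set_lebesgue_integral_def space_\<pi> \<pi>.emeasure_eq_measure intro: integrable_mult_indicator[of _ _ g, simplified])
  finally show "(LINT y:{0<..}|\<pi>. g y) + g 0 * measure \<pi> {0} =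
      (LINT x|\<pi>. LINT y|workload_kernel M X e F x. g y)"
    using integral_stationary_distribution[OF stat g, of B] B by (simp add: space_nn)
qed

end
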